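(* Let $f:\mathbb R^n\to[0,\infty)$ be an $L_p$-nested function and let $\boldsymbol x$ be $L_p$-nested symmetric distributed with respect to $f$ with radial density $\varrho$. Suppose we integrate out complete subtrees from the tree associated with $f$, that is, we transform subtrees into radial times uniform variables and integrate out the latter. Let $\mathcal J$ be the set of multi-indices of those nodes that have become new leaves, i.e. whose subtrees have been removed, and let $n_J$ be the number of leaves (in the original tree) in the subtree under the node $J$. Let $\boldsymbol x_{\widehat{\mathcal J}}\in\mathbb R^m$ denote those coefficients of $\boldsymbol x$ that are still part of that smaller tree, and let $\boldsymbol v_{\mathcal J}=(v_J)_{J\in\mathcal J}$, $v_J=f_J(\boldsymbol x_J)$, denote the vector of (values of) inner nodes that became new leaves. Then the joint distribution of $\boldsymbol x_{\widehat{\mathcal J}}$ and $\boldsymbol v_{\mathcal J}$ is given by $$\rho(\boldsymbol x_{\widehat{\mathcal J}},\boldsymbol v_{\mathcal J})=\frac{\varrho\big(f(\boldsymbol x_{\widehat{\mathcal J}},\boldsymbol v_{\mathcal J})\big)}{\mathcal S_f\big(f(\boldsymbol x_{\widehat{\mathcal J}},\boldsymbol v_{\mathcal J})\big)}\prod_{J\in\mathcal J}v_J^{n_J-1},$$ where $f(\boldsymbol x_{\widehat{\mathcal J}},\boldsymbol v_{\mathcal J})$ is the value at the root computed from the leaves of the smaller tree and $\mathcal S_f(R)$ is the surface area of the $L_p$-nested sphere of $f$ with radius $R$.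
   Context: **$L_p$-nested functions.** An $L_p$-nested function $f:\mathbb R^n\to[0,\infty)$ is given by a finite rooted ordered tree whose $n$ leaves correspond to the coordinates $x_1,\dots,x_n$; every inner node $I$ has $\ell_I\ge 2$ children, denoted $(I,1),\dots,(I,\ell_I)$, and carries an exponent $p_I>0$. Nodes are denoted by multi-indices describing the path from the root; the root is $\emptyset$. For a node $I$, $\boldsymbol x_I$ denotes the coordinates at leaves in the subtree under $I$, and $n_I$ the number of those leaves ($n_I=1$ if $I$ is a leaf). Put $f_I(\boldsymbol x_I)=|x_i|$ if $I$ is the leaf of $x_i$, and $f_I(\boldsymbol x_I)=\left(\sum_{k=1}^{\ell_I} f_{I,k}(\boldsymbol x_{I,k})^{p_I}\right)^{1/p_I}$ if $I$ is an inner node; $f=f_\emptyset$. **Surface area.** With $\mathcal I$ the set of all inner nodes (including the root) of the tree of $f$, the surface area of the $L_p$-nested sphere of $f$ with radius $R$ (the derivative in $R$ of the volume of $\{\boldsymbol x\in\mathbb R^n: f(\boldsymbol x)\le R\}$) is $$\mathcal S_f(R)=R^{n-1}2^n\prod_{I\in\mathcal I}\frac{\prod_{k=1}^{\ell_I}\Gamma\left[\frac{n_{I,k}}{p_I}\right]}{p_I^{\ell_I-1}\Gamma\left[\frac{n_I}{p_I}\right]}.$$ **$L_p$-nested symmetric distribution.** For a density $\varrho$ on $(0,\infty)$ (the radial density), the corresponding $L_p$-nested symmetric distribution has density $\rho(\boldsymbol x)=\dfrac{\varrho(f(\boldsymbol x))}{f(\boldsymbol x)^{n-1}\mathcal S_f(1)}=\dfrac{\varrho(f(\boldsymbol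 x))}{\mathcal S_f(f(\boldsymbol x))}$ on $\mathbb R^n$.
   Formalization: The displayed density is off by a constant (for f=|x_1|+|x_2| with the root removed its total mass is 1/4); the formal version multiplies it by the product over J of the surface areas S_{f_J}(1) of the unit spheres of the removed subtrees. *)

theory Defs
  imports "HOL-Probability.Probability" "HOL-Library.Sublist"
begin

section \<open>Trees and nested functions\<close>

(* An inner node carries its exponent and the ordered list of its children; a leaf carries
   the index of its coordinate. *)
datatype 'i lp_tree = Leaf 'i | Node real "'i lp_tree list"

fun leaves :: "'i lp_tree \<Rightarrow> 'i list" where
  "leaves (Leaf i) = [i]"
| "leaves (Node p ts) = concat (map leaves ts)"

abbreviation num_leaves :: "'i lp_tree \<Rightarrow> nat" where
  "num_leaves t \<equiv> length (leaves t)"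

fun admissible :: "'i lp_tree \<Rightarrow> bool" where
  "admissible (Leaf i) \<longleftrightarrow> True"
| "admissible (Node p ts) \<longleftrightarrow> 0 < p \<and> 2 \<le> length ts \<and> (\<forall>t\<in>set ts. admissible t)"

(* The coordinates x_1, ..., x_n are indexed by 0, ..., n - 1. *)
definition lp_nested_tree :: "nat \<Rightarrow> nat lp_tree \<Rightarrow> bool" where
  "lp_nested_tree n t \<longleftrightarrow> admissible t \<and> distinct (leaves t) \<and> set (leaves t) = {..<n}"

fun lp_fun :: "'i lp_tree \<Rightarrow> ('i \<Rightarrow> real) \<Rightarrow> real" where
  "lp_fun (Leaf i) x = \<bar>x i\<bar>"
| "lp_fun (Node p ts) x = (\<Sum>t\<leftarrow>ts. lp_fun t x powr p) powr (1 / p)"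


section \<open>Multi-indices\<close>

(* The subtree under the node with the given multi-index, if there is such a node. The empty
   multi-index is the root, and the children of a node are numbered from 0. *)
fun subtree :: "'i lp_tree \<Rightarrow> nat list \<Rightarrow> 'i lp_tree option" where
  "subtree t [] = Some t"
| "subtree (Leaf i) (k # I) = None"
| "subtree (Node p ts) (k # I) = (if k < length ts then subtree (ts ! k) I else None)"

definition inner_nodes :: "'i lp_tree \<Rightarrow> nat list set" where
  "inner_nodes t = {I. \<exists>p ts. subtree t I = Some (Node p ts)}"


section \<open>Surface area\<close>

fun node_factor :: "'i lp_tree \<Rightarrow> real" where
  "node_factor (Leaf i) = 1"
| "node_factor (Node p ts) =
     (\<Prod>k<length ts. Gamma (real (num_leaves (ts ! k)) / p)) /
     (p ^ (length ts - 1) * Gamma (real (num_leaves (Node p ts)) / p))"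

(* The surface area of the sphere of radius R of lp_fun t, in dimension num_leaves t. For the
   subtree s under a node, surface_area s 1 * v ^ (num_leaves s - 1) = surface_area s v is the
   density at v > 0 of the image of Lebesgue measure under lp_fun s. The constant
   surface_area s 1 is the mass contributed by the uniform component on the unit sphere
   of s when that component is integrated out. *)
definition surface_area :: "'i lp_tree \<Rightarrow> real \<Rightarrow> real" where
  "surface_area t R =
     R ^ (num_leaves t - 1) * 2 ^ num_leaves t *
     (\<Prod>I\<in>inner_nodes t. node_factor (the (subtree t I)))"


section \<open>Nested symmetric distributions\<close>

(* Only the values on the positive half-line matter; a density on that half-line is extended
   to a Borel function on the line in an arbitrary way. *)
definition radial_density :: "(real \<Rightarrow> real) \<Rightarrow> bool" where
  "radial_density \<rho> \<longleftrightarrow>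
     \<rho> \<in> borel_measurable borel \<and> (\<forall>r>0. 0 \<le> \<rho> r) \<and>
     (\<integral>\<^sup>+r\<in>{0<..}. ennreal (\<rho> r) \<partial>lborel) = 1"

abbreviation lebesgue_on_coords :: "'i set \<Rightarrow> ('i \<Rightarrow> real) measure" where
  "lebesgue_on_coords K \<equiv> Pi\<^sub>M K (\<lambda>_. lborel)"

definition lp_nested_symmetric ::
  "'a measure \<Rightarrow> nat \<Rightarrow> nat lp_tree \<Rightarrow> (real \<Rightarrow> real) \<Rightarrow> ('a \<Rightarrow> nat \<Rightarrow> real) \<Rightarrow> bool" where
  "lp_nested_symmetric M n t \<rho> X \<longleftrightarrow>
     distributed M (lebesgue_on_coords {..<n}) X
       (\<lambda>x. ennreal (\<rho> (lp_fun t x) / surface_area t (lp_fun t x)))"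


section \<open>Removing complete subtrees\<close>

(* No new leaf lies below another one, since nodes below a new leaf have been removed. *)
definition removable :: "'i lp_tree \<Rightarrow> nat list set \<Rightarrow> bool" where
  "removable t \<J> \<longleftrightarrow> \<J> \<subseteq> inner_nodes t \<and> (\<forall>I\<in>\<J>. \<forall>J\<in>\<J>. prefix I J \<longrightarrow> I = J)"

(* The tree in which the subtree under each J in the given set is replaced by a leaf Inr J,
   while a surviving leaf i becomes Inl i. The argument I is the multi-index, in the full tree,
   of the node being visited. *)
function prune_at :: "nat list \<Rightarrow> nat list set \<Rightarrow> 'i lp_tree \<Rightarrow> ('i + nat list) lp_tree" where
  "prune_at I \<J> (Leaf i) = Leaf (Inl i)"
| "prune_at I \<J> (Node p ts) =
     (if I \<in> \<J> then Leaf (Inr I)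
      else Node p (map (\<lambda>k. prune_at (I @ [k]) \<J> (ts ! k)) [0..<length ts]))"
  by pat_completeness auto
termination
  by (relation "Wellfounded.measure (\<lambda>(I, \<J>, t). size t)") (auto simp: less_Suc_eq_le intro!: size_list_estimation'[OF nth_mem])

abbreviation prune :: "nat list set \<Rightarrow> 'i lp_tree \<Rightarrow> ('i + nat list) lp_tree" where
  "prune \<equiv> prune_at []"

definition remaining_coords :: "nat list set \<Rightarrow> 'i lp_tree \<Rightarrow> 'i set" where
  "remaining_coords \<J> t = {i. Inl i \<in> set (leaves (prune \<J> t))}"

end

theory Submission
  imports Defs
begin

text \<open>
  Lebesgue measure on the coordinates under a node is mapped by the nested function of that node to
  a measure on the half-line with density \<open>c u\<^sup>a\<^sup>-\<^sup>1\<close>. This class of measures is closed under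
  \<open>u \<mapsto> u\<^sup>p\<close> and, by the Beta integral, under convolution, so climbing the tree produces the
  Gamma quotients in the surface area. The subtrees that are removed depend on disjoint blocks
  of coordinates, hence Lebesgue measure is mapped to the product of Lebesgue measure on the
  remaining coordinates with the radial measures of the removed subtrees. The density of \<open>X\<close> is a
  function of \<open>f(x)\<close>, which the pruned tree computes from the image point, so it passes through
  the image measure unchanged.
\<close>

section \<open>Measures with a power density on the half-line\<close>

text \<open>The constant \<open>c\<close> is not a normalisation: for \<open>c > 0\<close> these
  measures have infinite mass, as has the image of Lebesgue measure under a nested function. The
  exponent is shifted by one so that \<open>a\<close> behaves like a dimension: a node with
  \<open>m\<close> leaves has \<open>a = m\<close>, the map \<open>u powr p\<close> divides
  \<open>a\<close> by \<open>p\<close>, and convolution adds the two values of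
  \<open>a\<close>.\<close>

definition power_measure :: "real \<Rightarrow> real \<Rightarrow> real measure" where
  "power_measure c a = density lborel (\<lambda>u. ennreal (c * u powr (a - 1)) * indicator {0<..} u)"

lemma sets_power_measure [simp, measurable_cong]: "sets (power_measure c a) = sets borel"
  and space_power_measure [simp]: "space (power_measure c a) = UNIV"
  by (simp_all add: power_measure_def)

lemma sigma_finite_power_measure: "sigma_finite_measure (power_measure c a)"
  unfolding power_measure_def
  by (subst sigma_finite_measure.sigma_finite_iff_density_finite[OF sigma_finite_lborel])
    (auto simp: indicator_def ennreal_mult_eq_top_iff)

lemma nn_integral_power_measure:
  assumes [measurable]: "h \<in> borel_measurable borel"
  shows "(\<integral>\<^sup>+u. h u \<partial>power_measure c a) =
    (\<integral>\<^sup>+u. ennreal (c * u powr (a - 1)) * indicator {0<..} u * h u \<partial>lborel)"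
  unfolding power_measure_def by (subst nn_integral_density) auto

lemma emeasure_power_measure:
  assumes [measurable]: "A \<in> sets borel"
  shows "emeasure (power_measure c a) A =
    (\<integral>\<^sup>+u. ennreal (c * u powr (a - 1)) * indicator ({0<..} \<inter> A) u \<partial>lborel)"
  unfolding power_measure_def
  by (subst emeasure_density) (auto intro!: nn_integral_cong simp: indicator_def)

text \<open>Allows sublevel sets of powers to be compared at positive arguments only, where the
  power is strictly monotone.\<close>

lemma emeasure_power_measure_cong:
  assumes "A \<in> sets borel" "B \<in> sets borel" "A \<inter> {0<..} = B \<inter> {0<..}"
  shows "emeasure (power_measure c a) A = emeasure (power_measure c a) B"
  using assms by (simp add: emeasure_power_measure Int_commute)

lemma emeasure_power_measure_atMost:
  assumes "0 \<le> c" "0 < a"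
  shows "emeasure (power_measure c a) {..r} = ennreal (if r \<le> 0 then 0 else c * r powr a / a)"
proof (cases "r \<le> 0")
  case True
  then have "{0<..} \<inter> {..r} = {}" by auto
  with True show ?thesis by (simp add: emeasure_power_measure)
next
  case False
  have "((\<lambda>u. u powr (a - 1)) has_integral r powr a / a) {0..r}"
    using has_integral_powr_from_0[of "a - 1" r] assms False by simp
  from has_integral_mult_right[OF this, of c]
  have *: "((\<lambda>u. c * u powr (a - 1)) has_integral c * (r powr a / a)) {0..r}" .
  \<comment> \<open>The range of integration gains the point 0, where the integrand vanishes because
    \<open>0 powr (a - 1)\<close> is 0.\<close>
  have "emeasure (power_measure c a) {..r} =
      (\<integral>\<^sup>+u. indicator {0..r} u * (c * u powr (a - 1)) \<partial>lborel)"
    using False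
    by (auto simp: emeasure_power_measure indicator_def ennreal_mult' intro!: nn_integral_cong)
  also have "\<dots> = ennreal (c * (r powr a / a))"
    by (rule nn_integral_has_integral_lebesgue[OF _ *]) (use assms in auto)
  finally show ?thesis using False by simp
qed

text \<open>The distribution function determines the measure despite infinite mass: the half-lines
  are closed under intersection and generate the Borel sets, and those with integer end point
  exhaust the line with finite measure.\<close>

lemma power_measure_eqI:
  assumes "0 \<le> c" "0 < a" "sets N = sets borel"
    and "\<And>r. emeasure N {..r} = ennreal (if r \<le> 0 then 0 else c * r powr a / a)"
  shows "N = power_measure c a"
proof (rule measure_eqI_generator_eq[where E = "range atMost" and \<Omega> = UNIV and A = "\<lambda>i. {..real i}"])
  show "Int_stable (range (atMost :: real \<Rightarrow> _))"
    by (auto simp: Int_stable_def)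
  show "sets N = sigma_sets UNIV (range atMost)"
    "sets (power_measure c a) = sigma_sets UNIV (range atMost)"
    by (simp_all add: assms borel_eq_atMost)
  show "(\<Union>i. {..real i}) = UNIV"
    by (auto simp: real_arch_simple)
  show "emeasure N {..real i} \<noteq> \<infinity>" for i
    by (simp add: assms)
  show "emeasure N X = emeasure (power_measure c a) X" if "X \<in> range atMost" for X
    using that assms by (auto simp: emeasure_power_measure_atMost)
qed auto

text \<open>The case of a single leaf. The interval \<open>{-r..r}\<close> has length
  \<open>2 * r\<close>, which is where the factor 2 per coordinate in the surface area comes
  from.\<close>

lemma distr_lborel_abs: "distr lborel borel (\<lambda>x::real. \<bar>x\<bar>) = power_measure 2 1"
proof (rule power_measure_eqI)
  fix r :: real
  have "emeasure (distr lborel borel (\<lambda>x::real. \<bar>x\<bar>)) {..r} = emeasure lborel {-r..r}"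
    by (subst emeasure_distr) (auto intro!: arg_cong2[where f = emeasure])
  then show "emeasure (distr lborel borel (\<lambda>x::real. \<bar>x\<bar>)) {..r} =
      ennreal (if r \<le> 0 then 0 else 2 * r powr 1 / 1)"
    by (cases "r = 0") auto
qed auto

text \<open>For positive \<open>u\<close> and \<open>r\<close>, \<open>u powr p \<le> r\<close>
  means \<open>u \<le> r powr (1 / p)\<close>. The distribution function is therefore
  \<open>c * r powr (a / p) / a\<close>, in which a factor \<open>1 / p\<close> is inserted above
  and below.\<close>

lemma distr_power_measure_powr:
  assumes "0 \<le> c" "0 < a" "0 < p"
  shows "distr (power_measure c a) borel (\<lambda>u. u powr p) = power_measure (c / p) (a / p)"
proof (rule power_measure_eqI)
  fix r :: real
  have 1: "emeasure (distr (power_measure c a) borel (\<lambda>u. u powr p)) {..r} =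
      emeasure (power_measure c a) {u. u powr p \<le> r}"
    by (subst emeasure_distr) (auto intro!: arg_cong2[where f = emeasure])
  show "emeasure (distr (power_measure c a) borel (\<lambda>u. u powr p)) {..r} =
      ennreal (if r \<le> 0 then 0 else c / p * r powr (a / p) / (a / p))"
  proof (cases "r \<le> 0")
    case True
    have "\<not> u powr p \<le> r" if "0 < u" for u
      using True that powr_gt_zero[of u p] by linarith
    then have "emeasure (power_measure c a) {u. u powr p \<le> r} = emeasure (power_measure c a) {}"
      by (intro emeasure_power_measure_cong) auto
    with 1 True show ?thesis by simp
  next
    case False
    have "u powr p \<le> r \<longleftrightarrow> u \<le> r powr (1 / p)" if "0 < u" for u
    proof -
      have "u powr p \<le> r \<longleftrightarrow> u powr p \<le> (r powr (1 / p)) powr p"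
        using assms False by (simp add: powr_powr)
      also have "\<dots> \<longleftrightarrow> u \<le> r powr (1 / p)"
        using assms that powr_mono2[of p u "r powr (1 / p)"] powr_less_mono2[of p "r powr (1 / p)" u]
        by (cases "u \<le> r powr (1 / p)") auto
      finally show ?thesis .
    qed
    then have "emeasure (power_measure c a) {u. u powr p \<le> r} =
        emeasure (power_measure c a) {..r powr (1 / p)}"
      by (intro emeasure_power_measure_cong) auto
    then show ?thesis
      using 1 False assms by (simp add: emeasure_power_measure_atMost powr_powr)
  qed
qed (use assms in auto)

text \<open>Replacing \<open>t\<close> by \<open>s * t\<close> reduces this to the unit interval;
  the Jacobian \<open>s\<close> and the two powers of \<open>s\<close> combine to
  \<open>s powr (a + b - 1)\<close>.\<close>

lemma nn_integral_Beta_scaled: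
  fixes a b s :: real
  assumes "0 < a" "0 < b" "0 < s"
  shows "(\<integral>\<^sup>+t. ennreal (indicator {0<..<s} t * (t powr (a - 1) * (s - t) powr (b - 1))) \<partial>lborel) =
    ennreal (Beta a b * s powr (a + b - 1))"
proof -
  have I: "((\<lambda>t. t powr (a - 1) * (1 - t) powr (b - 1)) has_integral Beta a b) {0<..<1}"
    using has_integral_Beta_real[of a b] assms by (simp add: has_integral_Icc_iff_Ioo)
  have "(\<integral>\<^sup>+t. ennreal (indicator {0<..<s} t * (t powr (a - 1) * (s - t) powr (b - 1))) \<partial>lborel) =
      ennreal \<bar>s\<bar> * (\<integral>\<^sup>+t. ennreal (indicator {0<..<s} (0 + s * t) *
        ((0 + s * t) powr (a - 1) * (s - (0 + s * t)) powr (b - 1))) \<partial>lborel)"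
    by (rule nn_integral_real_affine) (use assms in auto)
  also have "\<dots> = (\<integral>\<^sup>+t. ennreal (s powr (a + b - 1)) *
      ennreal (indicator {0<..<1} t * (t powr (a - 1) * (1 - t) powr (b - 1))) \<partial>lborel)"
  proof (subst nn_integral_cmult[symmetric], goal_cases)
    case 2
    show ?case
    proof (rule nn_integral_cong)
      fix t :: real
      have "s * ((s * t) powr (a - 1) * (s - s * t) powr (b - 1)) =
          s powr (a + b - 1) * (t powr (a - 1) * (1 - t) powr (b - 1))" if "0 < t" "t < 1"
      proof -
        have "s * ((s * t) powr (a - 1) * (s - s * t) powr (b - 1)) =
            s powr 1 * ((s * t) powr (a - 1) * (s * (1 - t)) powr (b - 1))"
          using assms by (simp add: algebra_simps)
        also have "\<dots> = (s powr 1 * s powr (a - 1) * s powr (b - 1)) *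
            (t powr (a - 1) * (1 - t) powr (b - 1))"
          using assms that by (simp add: powr_mult mult_ac)
        also have "s powr 1 * s powr (a - 1) * s powr (b - 1) = s powr (a + b - 1)"
          by (simp only: powr_add[symmetric]) (simp add: algebra_simps)
        finally show ?thesis .
      qed
      moreover have "0 < s * t \<longleftrightarrow> 0 < t" "s * t < s \<longleftrightarrow> t < 1"
        using assms by (auto simp: zero_less_mult_iff)
      ultimately show "ennreal \<bar>s\<bar> * ennreal (indicator {0<..<s} (0 + s * t) *
          ((0 + s * t) powr (a - 1) * (s - (0 + s * t)) powr (b - 1))) =
        ennreal (s powr (a + b - 1)) *
          ennreal (indicator {0<..<1} t * (t powr (a - 1) * (1 - t) powr (b - 1)))"
        using assms by (auto simp: indicator_def ennreal_mult'[symmetric])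
    qed
  qed auto
  also have "\<dots> = ennreal (s powr (a + b - 1)) *
      (\<integral>\<^sup>+t. indicator {0<..<1} t * (t powr (a - 1) * (1 - t) powr (b - 1)) \<partial>lborel)"
    by (subst nn_integral_cmult) (auto simp: mult.assoc)
  also have "(\<integral>\<^sup>+t. indicator {0<..<1} t * (t powr (a - 1) * (1 - t) powr (b - 1)) \<partial>lborel) =
      ennreal (Beta a b)"
    by (rule nn_integral_has_integral_lebesgue[OF _ I]) auto
  finally show ?thesis
    by (simp add: ennreal_mult'' mult.commute)
qed

text \<open>The density of the sum at \<open>t\<close> is \<open>c * d\<close> times the integral of
  \<open>u powr (a - 1) * (t - u) powr (b - 1)\<close> over \<open>0 < u < t\<close>, a scaled Beta
  integral.\<close>

lemma convolution_power_measure: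
  assumes "0 \<le> c" "0 \<le> d" "0 < a" "0 < b"
  shows "distr (power_measure c a \<Otimes>\<^sub>M power_measure d b) borel (\<lambda>(u, w). u + w) =
    power_measure (c * d * Beta a b) (a + b)"
proof (rule measure_eqI)
  fix A assume "A \<in> sets (distr (power_measure c a \<Otimes>\<^sub>M power_measure d b) borel (\<lambda>(u, w). u + w))"
  then have [measurable]: "A \<in> sets borel" by simp
  interpret P: sigma_finite_measure "power_measure d b"
    by (rule sigma_finite_power_measure)
  \<comment> \<open>The joint density in the variables \<open>u\<close> and
    \<open>t = u + w\<close>, cut down to \<open>A\<close>: the condition \<open>0 < w\<close> has
    become \<open>u < t\<close>.\<close>
  let ?g = "\<lambda>u t. ennreal (c * u powr (a - 1) * (d * (t - u) powr (b - 1))) *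
      (indicator {0<..} u * indicator {u<..} t * indicator A t)"
  have "emeasure (distr (power_measure c a \<Otimes>\<^sub>M power_measure d b) borel (\<lambda>(u, w). u + w)) A =
      (\<integral>\<^sup>+z. indicator A (fst z + snd z) \<partial>(power_measure c a \<Otimes>\<^sub>M power_measure d b))"
    using nn_integral_distr[where f = "indicator A" and T = "\<lambda>z. fst z + snd z"
        and M = "power_measure c a \<Otimes>\<^sub>M power_measure d b" and M' = borel]
    by (simp add: case_prod_beta')
  also have "\<dots> = (\<integral>\<^sup>+u. \<integral>\<^sup>+w. indicator A (u + w) \<partial>power_measure d b \<partial>power_measure c a)"
    by (subst P.nn_integral_fst[symmetric]) auto
  also have "\<dots> = (\<integral>\<^sup>+u. \<integral>\<^sup>+t. ?g u t \<partial>lborel \<partial>lborel)"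
  proof -
    have "(\<integral>\<^sup>+u. \<integral>\<^sup>+w. indicator A (u + w) \<partial>power_measure d b \<partial>power_measure c a) =
      (\<integral>\<^sup>+u. ennreal (c * u powr (a - 1)) * indicator {0<..} u *
        (\<integral>\<^sup>+w. indicator A (u + w) \<partial>power_measure d b) \<partial>lborel)"
      by (rule nn_integral_power_measure) measurable
    also have "\<dots> = (\<integral>\<^sup>+u. \<integral>\<^sup>+t. ?g u t \<partial>lborel \<partial>lborel)"
    proof (rule nn_integral_cong)
      fix u :: real
      have "(\<integral>\<^sup>+w. indicator A (u + w) \<partial>power_measure d b) =
        (\<integral>\<^sup>+w. ennreal (d * w powr (b - 1)) * indicator {0<..} w * indicator A (u + w) \<partial>lborel)"
        by (rule nn_integral_power_measure) measurable
      also have "\<dots> = (\<integral>\<^sup>+t. ennreal (d * (t - u) powr (b - 1)) * indicator {u<..} t * indicator A t \<partial>lborel)"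
        by (subst nn_integral_real_affine[where c = 1 and t = "-u"])
          (auto intro!: nn_integral_cong simp: indicator_def)
      finally have "ennreal (c * u powr (a - 1)) * indicator {0<..} u *
          (\<integral>\<^sup>+w. indicator A (u + w) \<partial>power_measure d b) =
        (\<integral>\<^sup>+t. ennreal (c * u powr (a - 1)) * indicator {0<..} u *
          (ennreal (d * (t - u) powr (b - 1)) * indicator {u<..} t * indicator A t) \<partial>lborel)"
        by (simp only: nn_integral_cmult) (subst nn_integral_cmult, auto)
      also have "\<dots> = (\<integral>\<^sup>+t. ?g u t \<partial>lborel)"
        using assms by (intro nn_integral_cong) (auto simp: indicator_def ennreal_mult'[symmetric])
      finally show "ennreal (c * u powr (a - 1)) * indicator {0<..} u *
          (\<integral>\<^sup>+w. indicator A (u + w) \<partial>power_measure d b) = (\<integral>\<^sup>+t. ?g u t \<partial>lborel)" .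
    qed
    finally show ?thesis .
  qed
  also have "\<dots> = (\<integral>\<^sup>+t. \<integral>\<^sup>+u. ?g u t \<partial>lborel \<partial>lborel)"
    by (subst lborel_pair.Fubini') (auto simp: case_prod_beta indicator_def greaterThan_def)
  also have "\<dots> = emeasure (power_measure (c * d * Beta a b) (a + b)) A"
    unfolding emeasure_power_measure[OF \<open>A \<in> sets borel\<close>]
  proof (rule nn_integral_cong)
    fix t :: real
    have "(\<integral>\<^sup>+u. ?g u t \<partial>lborel) = (\<integral>\<^sup>+u. ennreal (c * d) * indicator A t *
        ennreal (indicator {0<..<t} u * (u powr (a - 1) * (t - u) powr (b - 1))) \<partial>lborel)"
      using assms by (intro nn_integral_cong) (auto simp: indicator_def ennreal_mult'[symmetric] mult_ac)
    also have "\<dots> = ennreal (c * d) * indicator A t *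
        (\<integral>\<^sup>+u. ennreal (indicator {0<..<t} u * (u powr (a - 1) * (t - u) powr (b - 1))) \<partial>lborel)"
      by (subst nn_integral_cmult) auto
    also have "\<dots> = ennreal (c * d * Beta a b * t powr (a + b - 1)) * indicator ({0<..} \<inter> A) t"
    proof (cases "0 < t")
      case True
      then show ?thesis
        using assms
        by (subst nn_integral_Beta_scaled) (auto simp: indicator_def ennreal_mult'[symmetric] mult_ac)
    next
      case False
      then show ?thesis by (simp add: indicator_def)
    qed
    finally show "(\<integral>\<^sup>+u. ?g u t \<partial>lborel) =
        ennreal (c * d * Beta a b * t powr (a + b - 1)) * indicator ({0<..} \<inter> A) t" .
  qed
  finally show "emeasure (distr (power_measure c a \<Otimes>\<^sub>M power_measure d b) borel (\<lambda>(u, w). u + w)) A =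
      emeasure (power_measure (c * d * Beta a b) (a + b)) A" .
qed simp


section \<open>Product measures split into blocks of coordinates\<close>

text \<open>\<open>merge\<close> carries the pair of products to the product over the union, and
  restricting to the two blocks undoes \<open>merge\<close>.\<close>

lemma (in product_sigma_finite) distr_restrict_pair:
  assumes "A \<inter> B = {}" "finite A" "finite B"
  shows "distr (Pi\<^sub>M (A \<union> B) M) (Pi\<^sub>M A M \<Otimes>\<^sub>M Pi\<^sub>M B M) (\<lambda>x. (restrict x A, restrict x B)) =
    Pi\<^sub>M A M \<Otimes>\<^sub>M Pi\<^sub>M B M"
proof -
  have [measurable]: "(\<lambda>x. (restrict x A, restrict x B)) \<in>
      Pi\<^sub>M (A \<union> B) M \<rightarrow>\<^sub>M Pi\<^sub>M A M \<Otimes>\<^sub>M Pi\<^sub>M B M"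
    by (intro measurable_Pair measurable_restrict_subset) auto
  have "distr (Pi\<^sub>M (A \<union> B) M) (Pi\<^sub>M A M \<Otimes>\<^sub>M Pi\<^sub>M B M) (\<lambda>x. (restrict x A, restrict x B)) =
      distr (distr (Pi\<^sub>M A M \<Otimes>\<^sub>M Pi\<^sub>M B M) (Pi\<^sub>M (A \<union> B) M) (merge A B))
        (Pi\<^sub>M A M \<Otimes>\<^sub>M Pi\<^sub>M B M) (\<lambda>x. (restrict x A, restrict x B))"
    using assms by (simp add: distr_merge)
  also have "\<dots> = distr (Pi\<^sub>M A M \<Otimes>\<^sub>M Pi\<^sub>M B M) (Pi\<^sub>M A M \<Otimes>\<^sub>M Pi\<^sub>M B M)
      ((\<lambda>x. (restrict x A, restrict x B)) \<circ> merge A B)"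
    by (intro distr_distr) simp_all
  also have "\<dots> = distr (Pi\<^sub>M A M \<Otimes>\<^sub>M Pi\<^sub>M B M) (Pi\<^sub>M A M \<Otimes>\<^sub>M Pi\<^sub>M B M) (\<lambda>x. x)"
    using assms by (intro distr_cong) (auto simp: space_pair_measure space_PiM PiE_restrict)
  finally show ?thesis
    by (simp add: distr_id)
qed

text \<open>The analogue, for measures that need not be finite, of the independence of functions of
  disjoint blocks of coordinates.\<close>

lemma (in product_sigma_finite) distr_pair_blocks:
  assumes "A \<inter> B = {}" "finite A" "finite B"
    and f: "f \<in> Pi\<^sub>M A M \<rightarrow>\<^sub>M S" and g: "g \<in> Pi\<^sub>M B M \<rightarrow>\<^sub>M T"
    and "sigma_finite_measure (distr (Pi\<^sub>M B M) T g)"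
  shows "distr (Pi\<^sub>M (A \<union> B) M) (S \<Otimes>\<^sub>M T) (\<lambda>x. (f (restrict x A), g (restrict x B))) =
    distr (Pi\<^sub>M A M) S f \<Otimes>\<^sub>M distr (Pi\<^sub>M B M) T g"
proof -
  have "distr (Pi\<^sub>M A M) S f \<Otimes>\<^sub>M distr (Pi\<^sub>M B M) T g =
      distr (distr (Pi\<^sub>M (A \<union> B) M) (Pi\<^sub>M A M \<Otimes>\<^sub>M Pi\<^sub>M B M) (\<lambda>x. (restrict x A, restrict x B)))
        (S \<Otimes>\<^sub>M T) (\<lambda>(x, y). (f x, g y))"
    using assms by (simp add: distr_restrict_pair pair_measure_distr)
  also have "\<dots> = distr (Pi\<^sub>M (A \<union> B) M) (S \<Otimes>\<^sub>M T)
      ((\<lambda>(x, y). (f x, g y)) \<circ> (\<lambda>x. (restrict x A, restrict x B)))"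
    using f g
    by (intro distr_distr measurable_Pair measurable_restrict_subset)
      (auto simp: case_prod_beta' intro!: measurable_Pair)
  finally show ?thesis by (simp add: comp_def)
qed

text \<open>Since \<open>i\<close> lies outside \<open>I\<close>, the preimage of a box under the
  update is again a box, so both measures agree on boxes. This puts a vector back together after one
  coordinate has been treated separately.\<close>

lemma (in product_sigma_finite) distr_fun_upd:
  assumes "finite I" "i \<notin> I"
  shows "distr (M i \<Otimes>\<^sub>M Pi\<^sub>M I M) (Pi\<^sub>M (insert i I) M) (\<lambda>(a, v). v(i := a)) =
    Pi\<^sub>M (insert i I) M"
proof (rule PiM_eqI)
  interpret I: finite_product_sigma_finite M I by standard fact
  have [measurable]: "(\<lambda>(a, v). v(i := a)) \<in> M i \<Otimes>\<^sub>M Pi\<^sub>M I M \<rightarrow>\<^sub>M Pi\<^sub>M (insert i I) M"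
    unfolding case_prod_beta' by (rule measurable_fun_upd[where J = I]) auto
  fix A assume A: "\<And>j. j \<in> insert i I \<Longrightarrow> A j \<in> sets (M j)"
  have *: "(\<lambda>(a, v). v(i := a)) -` Pi\<^sub>E (insert i I) A \<inter> space (M i \<Otimes>\<^sub>M Pi\<^sub>M I M) = A i \<times> Pi\<^sub>E I A"
  proof (intro set_eqI, clarify)
    fix a v
    have "v(i := a) \<in> Pi\<^sub>E (insert i I) A \<and> v \<in> extensional I \<longleftrightarrow> a \<in> A i \<and> v \<in> Pi\<^sub>E I A"
      using assms(2) by (auto simp: PiE_iff extensional_def)
    moreover have "a \<in> A i \<and> v \<in> Pi\<^sub>E I A \<Longrightarrow> a \<in> space (M i) \<and> v \<in> space (Pi\<^sub>M I M)"
      using A[THEN sets.sets_into_space] by (auto simp: space_PiM PiE_iff)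
    moreover have "v \<in> space (Pi\<^sub>M I M) \<Longrightarrow> v \<in> extensional I"
      by (simp add: space_PiM PiE_iff)
    ultimately show "(a, v) \<in> (\<lambda>(a, v). v(i := a)) -` Pi\<^sub>E (insert i I) A \<inter> space (M i \<Otimes>\<^sub>M Pi\<^sub>M I M) \<longleftrightarrow>
        (a, v) \<in> A i \<times> Pi\<^sub>E I A"
      by (simp add: space_pair_measure) blast
  qed
  show "emeasure (distr (M i \<Otimes>\<^sub>M Pi\<^sub>M I M) (Pi\<^sub>M (insert i I) M) (\<lambda>(a, v). v(i := a)))
      (Pi\<^sub>E (insert i I) A) = (\<Prod>j\<in>insert i I. emeasure (M j) (A j))"
    using A assms
    by (subst emeasure_distr) (auto simp: * I.emeasure_pair_measure_Times I.measure_times)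
qed (use assms in auto)

text \<open>Induction on the number of blocks: the new block is separated from the union of the
  others by \<open>distr_pair_blocks\<close>, and its value is inserted into the vector of the other
  values by \<open>distr_fun_upd\<close>.\<close>

lemma (in product_sigma_finite) distr_blocks:
  assumes "finite J" "product_sigma_finite D" "disjoint_family_on K J"
    and "\<And>j. j \<in> J \<Longrightarrow> finite (K j)"
    and "\<And>j. j \<in> J \<Longrightarrow> h j \<in> Pi\<^sub>M (K j) M \<rightarrow>\<^sub>M D j"
    and "\<And>j. j \<in> J \<Longrightarrow> distr (Pi\<^sub>M (K j) M) (D j) (h j) = D j"
  shows "distr (Pi\<^sub>M (\<Union>j\<in>J. K j) M) (Pi\<^sub>M J D) (\<lambda>x. \<lambda>j\<in>J. h j (restrict x (K j))) = Pi\<^sub>M J D"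
  using assms
proof (induction J rule: finite_induct)
  case empty
  \<comment> \<open>Both sides are the unit mass on the only point of a product over the empty
    set.\<close>
  then show ?case
    by (intro measure_eqI) (auto simp: PiM_empty emeasure_distr restrict_def subset_singleton_iff)
next
  case (insert i J)
  interpret D: product_sigma_finite D by fact
  let ?U = "\<Union>j\<in>J. K j"
  let ?g = "\<lambda>x. \<lambda>j\<in>J. h j (restrict x (K j))"
  have disj: "K i \<inter> ?U = {}" "disjoint_family_on K J"
    using insert.hyps insert.prems(2) by (force simp: disjoint_family_on_def)+
  have IH: "distr (Pi\<^sub>M ?U M) (Pi\<^sub>M J D) ?g = Pi\<^sub>M J D"
    using insert.prems disj by (intro insert.IH) auto
  have h: "h j \<in> Pi\<^sub>M (K j) M \<rightarrow>\<^sub>M D j" if "j \<in> insert i J" for j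
    using insert.prems(4) that by auto
  have hr: "(\<lambda>x. h j (restrict x (K j))) \<in> Pi\<^sub>M L M \<rightarrow>\<^sub>M D j" if "j \<in> insert i J" "K j \<subseteq> L" for j L
    by (rule measurable_compose[OF measurable_restrict_subset[OF that(2)] h[OF that(1)]])
  have g: "?g \<in> Pi\<^sub>M L M \<rightarrow>\<^sub>M Pi\<^sub>M J D" if "?U \<subseteq> L" for L
    by (rule measurable_restrict, rule hr) (use that in auto)
  have gr: "(\<lambda>x. ?g (restrict x ?U)) \<in> Pi\<^sub>M (K i \<union> ?U) M \<rightarrow>\<^sub>M Pi\<^sub>M J D"
    by (rule measurable_compose[OF measurable_restrict_subset g]) auto
  have upd: "(\<lambda>(a, v). v(i := a)) \<in> D i \<Otimes>\<^sub>M Pi\<^sub>M J D \<rightarrow>\<^sub>M Pi\<^sub>M (insert i J) D"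
    unfolding case_prod_beta' by (rule measurable_fun_upd[where J = J]) auto
  have "distr (Pi\<^sub>M (K i \<union> ?U) M) (D i \<Otimes>\<^sub>M Pi\<^sub>M J D)
      (\<lambda>x. (h i (restrict x (K i)), ?g (restrict x ?U))) =
      distr (Pi\<^sub>M (K i) M) (D i) (h i) \<Otimes>\<^sub>M distr (Pi\<^sub>M ?U M) (Pi\<^sub>M J D) ?g"
  proof (rule distr_pair_blocks[OF disj(1)])
    \<comment> \<open>An image of a sigma-finite measure can fail to be sigma-finite; here the
      induction hypothesis identifies it with a product of sigma-finite measures.\<close>
    show "sigma_finite_measure (distr (Pi\<^sub>M ?U M) (Pi\<^sub>M J D) ?g)"
      unfolding IH by (rule D.sigma_finite[OF insert.hyps(1)])
    show "h i \<in> Pi\<^sub>M (K i) M \<rightarrow>\<^sub>M D i" by (rule h) simp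
    show "?g \<in> Pi\<^sub>M ?U M \<rightarrow>\<^sub>M Pi\<^sub>M J D" by (rule g) simp
    show "finite (K i)" "finite ?U" using insert.hyps insert.prems(3) by auto
  qed
  also have "\<dots> = D i \<Otimes>\<^sub>M Pi\<^sub>M J D"
    by (simp only: IH insert.prems(5)[OF insertI1])
  finally have "distr (Pi\<^sub>M (K i \<union> ?U) M) (D i \<Otimes>\<^sub>M Pi\<^sub>M J D)
      (\<lambda>x. (h i (restrict x (K i)), ?g (restrict x ?U))) = D i \<Otimes>\<^sub>M Pi\<^sub>M J D" .
  then have "Pi\<^sub>M (insert i J) D = distr (distr (Pi\<^sub>M (K i \<union> ?U) M) (D i \<Otimes>\<^sub>M Pi\<^sub>M J D)
      (\<lambda>x. (h i (restrict x (K i)), ?g (restrict x ?U)))) (Pi\<^sub>M (insert i J) D) (\<lambda>(a, v). v(i := a))"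
    by (simp only: D.distr_fun_upd[OF insert.hyps])
  also have "\<dots> = distr (Pi\<^sub>M (K i \<union> ?U) M) (Pi\<^sub>M (insert i J) D)
      ((\<lambda>(a, v). v(i := a)) \<circ> (\<lambda>x. (h i (restrict x (K i)), ?g (restrict x ?U))))"
    by (intro distr_distr[OF upd] measurable_Pair hr gr) auto
  also have "\<dots> = distr (Pi\<^sub>M (K i \<union> ?U) M) (Pi\<^sub>M (insert i J) D)
      (\<lambda>x. \<lambda>j\<in>insert i J. h j (restrict x (K j)))"
  proof (rule distr_cong[OF refl refl])
    fix x
    show "((\<lambda>(a, v). v(i := a)) \<circ> (\<lambda>x. (h i (restrict x (K i)), ?g (restrict x ?U)))) x =
        (\<lambda>j\<in>insert i J. h j (restrict x (K j)))"
    proof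
      fix k
      have "restrict (restrict x ?U) (K k) = restrict x (K k)" if "k \<in> J"
        using that by (subst restrict_restrict) (auto intro: arg_cong2[where f = restrict])
      then show "((\<lambda>(a, v). v(i := a)) \<circ> (\<lambda>x. (h i (restrict x (K i)), ?g (restrict x ?U)))) x k =
          (\<lambda>j\<in>insert i J. h j (restrict x (K j))) k"
        by simp
    qed
  qed
  finally show ?case by (simp only: UN_insert)
qed

text \<open>The indicator of a box factors over the coordinates, so the integral of the product
  density over a box is a product of one-dimensional integrals, and boxes determine the product
  measure.\<close>

lemma (in product_sigma_finite) PiM_density:
  assumes "finite J" "\<And>j. j \<in> J \<Longrightarrow> d j \<in> borel_measurable (M j)"
    and "product_sigma_finite (\<lambda>j. density (M j) (d j))"
  shows "Pi\<^sub>M J (\<lambda>j. density (M j) (d j)) = density (Pi\<^sub>M J M) (\<lambda>v. \<Prod>j\<in>J. d j (v j))"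
proof -
  interpret D: product_sigma_finite "\<lambda>j. density (M j) (d j)" by fact
  have [measurable]: "(\<lambda>v. d j (v j)) \<in> borel_measurable (Pi\<^sub>M J M)" if "j \<in> J" for j
    by (rule measurable_compose[OF measurable_component_singleton[where M = M, OF that] assms(2)[OF that]])
  have "density (Pi\<^sub>M J M) (\<lambda>v. \<Prod>j\<in>J. d j (v j)) = Pi\<^sub>M J (\<lambda>j. density (M j) (d j))"
  proof (rule D.PiM_eqI)
    fix A assume "\<And>j. j \<in> J \<Longrightarrow> A j \<in> sets (density (M j) (d j))"
    then have A: "\<And>j. j \<in> J \<Longrightarrow> A j \<in> sets (M j)" by simp
    have "emeasure (density (Pi\<^sub>M J M) (\<lambda>v. \<Prod>j\<in>J. d j (v j))) (Pi\<^sub>E J A) =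
        (\<integral>\<^sup>+v. (\<Prod>j\<in>J. d j (v j)) * indicator (Pi\<^sub>E J A) v \<partial>Pi\<^sub>M J M)"
      using A assms(1) by (intro emeasure_density) (auto intro!: sets_PiM_I_finite)
    also have "\<dots> = (\<integral>\<^sup>+v. (\<Prod>j\<in>J. d j (v j) * indicator (A j) (v j)) \<partial>Pi\<^sub>M J M)"
    proof (rule nn_integral_cong)
      fix v assume "v \<in> space (Pi\<^sub>M J M)"
      then have "indicator (Pi\<^sub>E J A) v = (\<Prod>j\<in>J. indicator (A j) (v j) :: ennreal)"
        using assms(1)
        by (cases "v \<in> Pi\<^sub>E J A") (auto simp: space_PiM PiE_iff indicator_def intro!: prod_zero[symmetric])
      then show "(\<Prod>j\<in>J. d j (v j)) * indicator (Pi\<^sub>E J A) v =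
          (\<Prod>j\<in>J. d j (v j) * indicator (A j) (v j))"
        by (simp add: prod.distrib)
    qed
    also have "\<dots> = (\<Prod>j\<in>J. \<integral>\<^sup>+u. d j u * indicator (A j) u \<partial>M j)"
      using A assms(2) by (intro product_nn_integral_prod assms(1)) auto
    also have "\<dots> = (\<Prod>j\<in>J. emeasure (density (M j) (d j)) (A j))"
      using A assms(2) by (intro prod.cong) (auto simp: emeasure_density)
    finally show "emeasure (density (Pi\<^sub>M J M) (\<lambda>v. \<Prod>j\<in>J. d j (v j))) (Pi\<^sub>E J A) =
        (\<Prod>j\<in>J. emeasure (density (M j) (d j)) (A j))" .
  next
    show "sets (density (Pi\<^sub>M J M) (\<lambda>v. \<Prod>j\<in>J. d j (v j))) =
        sets (Pi\<^sub>M J (\<lambda>j. density (M j) (d j)))"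
      unfolding sets_density by (rule sets_PiM_cong) simp_all
  next
    show "finite J" by (rule assms(1))
  qed
  then show ?thesis by (rule sym)
qed


section \<open>The radial law of a nested function\<close>

lemma borel_measurable_sum_list:
  fixes f :: "'b \<Rightarrow> 'a \<Rightarrow> real"
  assumes "\<And>t. t \<in> set ts \<Longrightarrow> f t \<in> borel_measurable N"
  shows "(\<lambda>\<omega>. \<Sum>t\<leftarrow>ts. f t \<omega>) \<in> borel_measurable N"
  using assms by (induction ts) auto

lemma lp_fun_nonneg: "0 \<le> lp_fun t x"
  by (cases t) auto

lemma lp_fun_cong: "(\<And>i. i \<in> set (leaves t) \<Longrightarrow> x i = y i) \<Longrightarrow> lp_fun t x = lp_fun t y"
proof (induction t)
  case (Node p ts)
  have "lp_fun t x = lp_fun t y" if "t \<in> set ts" for t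
    by (rule Node.IH[OF that], rule Node.prems) (use that in auto)
  then have "map (\<lambda>t. lp_fun t x powr p) ts = map (\<lambda>t. lp_fun t y powr p) ts"
    by simp
  then show ?case by (simp only: lp_fun.simps)
qed simp

lemma lp_fun_restrict: "set (leaves t) \<subseteq> K \<Longrightarrow> lp_fun t (restrict x K) = lp_fun t x"
  by (rule lp_fun_cong) auto

text \<open>The argument passes through an arbitrary map \<open>g\<close> so that pruned trees are
  covered too: their leaves are read off a pair of vectors.\<close>

lemma borel_measurable_lp_fun:
  assumes "\<And>i. i \<in> set (leaves t) \<Longrightarrow> (\<lambda>\<omega>. g \<omega> i) \<in> borel_measurable N"
  shows "(\<lambda>\<omega>. lp_fun t (g \<omega>)) \<in> borel_measurable N"
  using assms
proof (induction t)
  case (Node p ts)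
  have "(\<lambda>\<omega>. \<Sum>t\<leftarrow>ts. lp_fun t (g \<omega>) powr p) \<in> borel_measurable N"
  proof (rule borel_measurable_sum_list)
    fix t assume "t \<in> set ts"
    with Node have [measurable]: "(\<lambda>\<omega>. lp_fun t (g \<omega>)) \<in> borel_measurable N"
      by auto
    show "(\<lambda>\<omega>. lp_fun t (g \<omega>) powr p) \<in> borel_measurable N" by measurable
  qed
  then show ?case by simp
qed simp

lemma borel_measurable_lp_fun_PiM:
  assumes "set (leaves t) \<subseteq> K"
  shows "lp_fun t \<in> borel_measurable (lebesgue_on_coords K)"
proof (rule borel_measurable_lp_fun)
  fix i assume "i \<in> set (leaves t)"
  with assms have "i \<in> K" by auto
  then have "(\<lambda>x. x i) \<in> lebesgue_on_coords K \<rightarrow>\<^sub>M lborel"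
    by (rule measurable_component_singleton)
  then show "(\<lambda>x. x i) \<in> borel_measurable (lebesgue_on_coords K)" by simp
qed

lemma num_leaves_pos: "admissible t \<Longrightarrow> 0 < num_leaves t"
proof (induction t)
  case (Node p ts)
  then obtain t where "t \<in> set ts" by (cases ts) auto
  with Node have "leaves t \<noteq> []" by auto
  with \<open>t \<in> set ts\<close> show ?case by auto
qed simp

section \<open>The surface area as a recursion over the tree\<close>

lemma inner_nodes_Leaf [simp]: "inner_nodes (Leaf i) = {}"
proof -
  have "subtree (Leaf i) I \<noteq> Some (Node p ts)" for I p and ts :: "'a lp_tree list"
    by (cases I) auto
  then show ?thesis by (simp add: inner_nodes_def)
qed

lemma inner_nodes_Node:
  "inner_nodes (Node p ts) = insert [] (\<Union>k<length ts. (#) k ` inner_nodes (ts ! k))"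
proof (rule set_eqI)
  fix I
  show "I \<in> inner_nodes (Node p ts) \<longleftrightarrow> I \<in> insert [] (\<Union>k<length ts. (#) k ` inner_nodes (ts ! k))"
    by (cases I) (auto simp: inner_nodes_def)
qed

lemma finite_inner_nodes: "finite (inner_nodes t)"
  by (induction t) (auto simp: inner_nodes_Node)

lemma surface_area_Leaf: "surface_area (Leaf i) 1 = 2"
  by (simp add: surface_area_def)

text \<open>The inner nodes are the root and disjoint shifted copies of the inner nodes of the
  children. This turns the product over multi-indices into a form suited to structural
  induction.\<close>

lemma surface_area_Node:
  "surface_area (Node p ts) 1 = node_factor (Node p ts) * (\<Prod>t\<leftarrow>ts. surface_area t 1)"
proof -
  let ?F = "\<lambda>t. \<Prod>I\<in>inner_nodes t. node_factor (the (subtree t I))"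
  have "(2::real) ^ num_leaves (Node p ts) = (\<Prod>t\<leftarrow>ts. 2 ^ num_leaves t)"
    by (induction ts) (auto simp: power_add)
  also have "\<dots> = (\<Prod>k<length ts. 2 ^ num_leaves (ts ! k))"
    by (simp add: prod.list_conv_set_nth atLeast0LessThan)
  finally have 1: "(2::real) ^ num_leaves (Node p ts) = (\<Prod>k<length ts. 2 ^ num_leaves (ts ! k))" .
  have "?F (Node p ts) = node_factor (Node p ts) *
      (\<Prod>I\<in>(\<Union>k<length ts. (#) k ` inner_nodes (ts ! k)). node_factor (the (subtree (Node p ts) I)))"
    unfolding inner_nodes_Node
    by (subst prod.insert) (auto intro: finite_inner_nodes)
  also have "(\<Prod>I\<in>(\<Union>k<length ts. (#) k ` inner_nodes (ts ! k)). node_factor (the (subtree (Node p ts) I))) =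
      (\<Prod>k<length ts. \<Prod>I\<in>(#) k ` inner_nodes (ts ! k). node_factor (the (subtree (Node p ts) I)))"
    by (rule prod.UNION_disjoint) (auto intro: finite_inner_nodes)
  also have "\<dots> = (\<Prod>k<length ts. ?F (ts ! k))"
    by (rule prod.cong) (auto simp: prod.reindex)
  finally have 2: "?F (Node p ts) = node_factor (Node p ts) * (\<Prod>k<length ts. ?F (ts ! k))" .
  have "surface_area (Node p ts) 1 = 2 ^ num_leaves (Node p ts) * ?F (Node p ts)"
    by (simp only: surface_area_def power_one mult_1)
  also have "\<dots> = node_factor (Node p ts) * (\<Prod>k<length ts. surface_area (ts ! k) 1)"
    unfolding 1 2 surface_area_def power_one mult_1 prod.distrib by (simp only: mult.left_commute)
  also have "(\<Prod>k<length ts. surface_area (ts ! k) 1) = (\<Prod>t\<leftarrow>ts. surface_area t 1)"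
    by (simp add: prod.list_conv_set_nth atLeast0LessThan)
  finally show ?thesis .
qed

section \<open>Climbing the tree from the leaves to the root\<close>

lemma product_sigma_finite_lborel: "product_sigma_finite (\<lambda>_. lborel)"
  by unfold_locales

text \<open>As \<open>Beta a b\<close> is \<open>Gamma a * Gamma b / Gamma (a + b)\<close>, the
  quantity \<open>c * Gamma a\<close> is multiplicative under convolution of power measures. The
  coefficient of the sum is thus the product of these quantities over the summands, divided by the
  Gamma value at the total exponent. Distinct leaves make the summands functions of disjoint
  blocks.\<close>

lemma distr_sum_list_lp_fun_powr:
  assumes "ts \<noteq> []" "0 < p" "distinct (concat (map leaves ts))"
    and "\<And>t. t \<in> set ts \<Longrightarrow> 0 < num_leaves t"
    and "\<And>t. t \<in> set ts \<Longrightarrow> 0 \<le> surface_area t 1"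
    and "\<And>t. t \<in> set ts \<Longrightarrow> distr (lebesgue_on_coords (set (leaves t))) borel (lp_fun t) =
      power_measure (surface_area t 1) (real (num_leaves t))"
  shows "distr (lebesgue_on_coords (set (concat (map leaves ts)))) borel
      (\<lambda>x. \<Sum>t\<leftarrow>ts. lp_fun t x powr p) =
    power_measure
      ((\<Prod>t\<leftarrow>ts. surface_area t 1 / p * Gamma (real (num_leaves t) / p)) /
        Gamma (real (length (concat (map leaves ts))) / p))
      (real (length (concat (map leaves ts))) / p)"
  using assms
proof (induction ts rule: list_nonempty_induct)
  {
    fix t :: "'a lp_tree"
    let ?L = "lebesgue_on_coords (set (leaves t))"
    assume t: "0 < num_leaves t" "0 \<le> surface_area t 1"
      "distr ?L borel (lp_fun t) = power_measure (surface_area t 1) (real (num_leaves t))"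
    have "distr ?L borel (\<lambda>x. lp_fun t x powr p) =
        distr (distr ?L borel (lp_fun t)) borel (\<lambda>u. u powr p)"
      by (subst distr_distr) (auto simp: comp_def borel_measurable_lp_fun_PiM)
    also have "\<dots> = power_measure (surface_area t 1 / p) (real (num_leaves t) / p)"
      using t \<open>0 < p\<close> by (simp add: distr_power_measure_powr)
    finally have "distr ?L borel (\<lambda>x. lp_fun t x powr p) =
      power_measure (surface_area t 1 / p) (real (num_leaves t) / p)" .
  } note powr = this
  {
    case (single t)
    \<comment> \<open>With a single summand the same Gamma value stands above and below, and it must
      be nonzero to cancel.\<close>
    moreover have "Gamma (real (num_leaves t) / p) \<noteq> 0"
      using single by (intro less_imp_neq[OF Gamma_real_pos, symmetric]) auto
    ultimately show ?case by (simp add: powr)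
  next
    case (cons t ts)
    interpret L: product_sigma_finite "\<lambda>_::'a. lborel :: real measure"
      by (rule product_sigma_finite_lborel)
    let ?A = "set (leaves t)" and ?B = "set (concat (map leaves ts))"
    let ?m = "real (num_leaves t)" and ?n = "real (length (concat (map leaves ts)))"
    let ?f = "\<lambda>x. lp_fun t x powr p" and ?g = "\<lambda>x. \<Sum>t\<leftarrow>ts. lp_fun t x powr p"
    let ?c = "\<Prod>t\<leftarrow>ts. surface_area t 1 / p * Gamma (real (num_leaves t) / p)"
    have IH: "distr (lebesgue_on_coords ?B) borel ?g = power_measure (?c / Gamma (?n / p)) (?n / p)"
      using cons.prems by (intro cons.IH) auto
    have ft: "distr (lebesgue_on_coords ?A) borel ?f = power_measure (surface_area t 1 / p) (?m / p)"
      using cons.prems by (intro powr) auto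
    have pos: "0 < ?m" "0 < ?n"
      using cons.prems(3) cons.hyps by (auto simp: neq_Nil_conv)
    then have Gam: "0 < Gamma (?n / p)" "0 < Gamma (?m / p)"
      using \<open>0 < p\<close> by (auto intro: Gamma_real_pos)
    have c: "0 \<le> ?c"
    proof (rule prod_list_nonneg)
      fix y assume "y \<in> set (map (\<lambda>t. surface_area t 1 / p * Gamma (real (num_leaves t) / p)) ts)"
      then obtain s where "s \<in> set ts" "y = surface_area s 1 / p * Gamma (real (num_leaves s) / p)"
        by auto
      moreover have "0 < Gamma (real (num_leaves s) / p)"
        using cons.prems(3)[of s] \<open>s \<in> set ts\<close> \<open>0 < p\<close> by (intro Gamma_real_pos) auto
      ultimately show "0 \<le> y" using cons.prems(4)[of s] \<open>0 < p\<close> by simp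
    qed
    have f: "?f \<in> borel_measurable (lebesgue_on_coords K)" if "?A \<subseteq> K" for K
      using borel_measurable_lp_fun_PiM[OF that] by measurable
    have g: "?g \<in> borel_measurable (lebesgue_on_coords K)" if "?B \<subseteq> K" for K
    proof (rule borel_measurable_sum_list)
      fix s assume "s \<in> set ts"
      then have "lp_fun s \<in> borel_measurable (lebesgue_on_coords K)"
        using that by (intro borel_measurable_lp_fun_PiM) auto
      then show "(\<lambda>x. lp_fun s x powr p) \<in> borel_measurable (lebesgue_on_coords K)"
        by measurable
    qed
    have gr: "?g (restrict x ?B) = ?g x" for x
      by (intro arg_cong[where f = sum_list] map_cong refl) (subst lp_fun_restrict, auto)
    have "distr (lebesgue_on_coords (?A \<union> ?B)) borel (\<lambda>x. ?f x + ?g x) =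
        distr (distr (lebesgue_on_coords (?A \<union> ?B)) (borel \<Otimes>\<^sub>M borel)
          (\<lambda>x. (?f (restrict x ?A), ?g (restrict x ?B)))) borel (\<lambda>(u, w). u + w)"
      unfolding gr lp_fun_restrict[OF order_refl]
      by (subst distr_distr) (auto simp: comp_def intro!: measurable_Pair f g)
    also have "\<dots> = distr (power_measure (surface_area t 1 / p) (?m / p) \<Otimes>\<^sub>M
        power_measure (?c / Gamma (?n / p)) (?n / p)) borel (\<lambda>(u, w). u + w)"
      using cons.prems(2) IH sigma_finite_power_measure
      by (subst L.distr_pair_blocks) (simp_all add: ft IH f g)
    also have "\<dots> = power_measure (surface_area t 1 / p * (?c / Gamma (?n / p)) *
        Beta (?m / p) (?n / p)) (?m / p + ?n / p)"
      using c pos Gam cons.prems \<open>0 < p\<close> by (intro convolution_power_measure) auto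
    \<comment> \<open>The Gamma value under the coefficient of the tail cancels against one in the
      numerator of the Beta function.\<close>
    also have "surface_area t 1 / p * (?c / Gamma (?n / p)) * Beta (?m / p) (?n / p) =
        surface_area t 1 / p * Gamma (?m / p) * ?c / Gamma ((?m + ?n) / p)"
      using Gam by (simp add: Beta_def add_divide_distrib)
    also have "?m / p + ?n / p = (?m + ?n) / p"
      by (simp add: add_divide_distrib)
    finally show ?case by simp
  }
qed

lemma surface_area_pos: "admissible t \<Longrightarrow> 0 < surface_area t 1"
proof (induction t)
  case (Node p ts)
  have "0 < Gamma (real (num_leaves s) / p)" if "s = Node p ts \<or> s \<in> set ts" for s
    using Node.prems that num_leaves_pos[of s] by (intro Gamma_real_pos divide_pos_pos) auto
  then have "0 < node_factor (Node p ts)"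
    using Node.prems by (auto simp del: leaves.simps intro!: divide_pos_pos mult_pos_pos prod_pos)
  moreover have "0 < (\<Prod>t\<leftarrow>ts. surface_area t 1)"
    using Node by (auto simp: prod.list_conv_set_nth intro!: prod_pos)
  ultimately show ?case by (simp only: surface_area_Node mult_pos_pos)
qed (simp add: surface_area_Leaf)

text \<open>This gives the closed Gamma formula its measure-theoretic meaning. At an inner node the
  laws of the children are raised to the power \<open>p\<close>, convolved, and taken back by the
  power \<open>1 / p\<close>.\<close>

lemma distr_lp_fun:
  assumes "admissible t" "distinct (leaves t)"
  shows "distr (lebesgue_on_coords (set (leaves t))) borel (lp_fun t) =
    power_measure (surface_area t 1) (real (num_leaves t))"
  using assms
proof (induction t)
  case (Leaf i)
  interpret L: product_sigma_finite "\<lambda>_::'a. lborel :: real measure"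
    by (rule product_sigma_finite_lborel)
  have "distr (lebesgue_on_coords {i}) borel (\<lambda>x. \<bar>x i\<bar>) =
      distr (distr (lebesgue_on_coords {i}) lborel (\<lambda>x. x i)) borel (\<lambda>u. \<bar>u\<bar>)"
    by (subst distr_distr) (auto simp: comp_def)
  then show ?case
    using L.distr_singleton[of i] by (simp add: distr_lborel_abs surface_area_Leaf)
next
  case (Node p ts)
  then have p: "0 < p" and len: "2 \<le> length ts" and adm: "\<And>t. t \<in> set ts \<Longrightarrow> admissible t"
    by auto
  let ?L = "lebesgue_on_coords (set (leaves (Node p ts)))"
  let ?S = "\<lambda>x. \<Sum>t\<leftarrow>ts. lp_fun t x powr p"
  let ?n = "real (num_leaves (Node p ts))"
  let ?c = "\<Prod>t\<leftarrow>ts. surface_area t 1 / p * Gamma (real (num_leaves t) / p)"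
  have n: "0 < ?n" using num_leaves_pos[OF Node.prems(1)] by simp
  have S: "distr ?L borel ?S = power_measure (?c / Gamma (?n / p)) (?n / p)"
    unfolding leaves.simps
  proof (rule distr_sum_list_lp_fun_powr)
    show "distr (lebesgue_on_coords (set (leaves t))) borel (lp_fun t) =
      power_measure (surface_area t 1) (real (num_leaves t))" if "t \<in> set ts" for t
      using Node that by (intro Node.IH) (auto simp: distinct_concat_iff)
    show "0 \<le> surface_area t 1" if "t \<in> set ts" for t
      using surface_area_pos[OF adm[OF that]] by simp
    show "0 < num_leaves t" if "t \<in> set ts" for t
      using num_leaves_pos[OF adm[OF that]] .
  qed (use Node.prems p len in auto)
  have "?S \<in> borel_measurable ?L"
  proof (rule borel_measurable_sum_list)
    fix s assume "s \<in> set ts"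
    then have "lp_fun s \<in> borel_measurable ?L"
      by (intro borel_measurable_lp_fun_PiM) auto
    then show "(\<lambda>x. lp_fun s x powr p) \<in> borel_measurable ?L" by measurable
  qed
  moreover have "lp_fun (Node p ts) = (\<lambda>u. u powr (1 / p)) \<circ> ?S"
    by (simp add: fun_eq_iff)
  ultimately have "distr ?L borel (lp_fun (Node p ts)) = distr (distr ?L borel ?S) borel (\<lambda>u. u powr (1 / p))"
    by (subst distr_distr) auto
  then have "distr ?L borel (lp_fun (Node p ts)) =
      distr (power_measure (?c / Gamma (?n / p)) (?n / p)) borel (\<lambda>u. u powr (1 / p))"
    by (simp only: S)
  also have "\<dots> = power_measure (?c / Gamma (?n / p) / (1 / p)) (?n / p / (1 / p))"
  proof (rule distr_power_measure_powr)
    have "0 \<le> Gamma (real (num_leaves s) / p)" if "s \<in> set ts" for s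
      using p num_leaves_pos[OF adm[OF that]] by (intro less_imp_le Gamma_real_pos) auto
    then have "0 \<le> ?c"
      using surface_area_pos[OF adm] p by (intro prod_list_nonneg) (auto simp: less_imp_le)
    then show "0 \<le> ?c / Gamma (?n / p)"
      using n p by (intro divide_nonneg_pos Gamma_real_pos) auto
  qed (use n p in auto)
  also have "?n / p / (1 / p) = ?n" using p by simp
  \<comment> \<open>Each child brings a factor \<open>1 / p\<close> and the final root returns one
    factor \<open>p\<close>; hence the exponent \<open>length ts - 1\<close> in
    \<open>node_factor\<close>.\<close>
  also have "?c / Gamma (?n / p) / (1 / p) = surface_area (Node p ts) 1"
  proof -
    have "?c = (\<Prod>k<length ts. Gamma (real (num_leaves (ts ! k)) / p)) *
        (\<Prod>t\<leftarrow>ts. surface_area t 1) / p ^ length ts"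
      by (simp add: prod.list_conv_set_nth atLeast0LessThan prod.distrib prod_dividef)
    moreover have "p ^ length ts = p * p ^ (length ts - 1)"
      using len by (cases ts) auto
    ultimately show ?thesis using p by (simp add: surface_area_Node del: leaves.simps)
  qed
  finally show ?case .
qed


section \<open>Pruned trees\<close>

lemma disjoint_leaves_nth:
  assumes "distinct (concat (map leaves ts))" "j < length ts" "k < length ts" "j \<noteq> k"
  shows "set (leaves (ts ! j)) \<inter> set (leaves (ts ! k)) = {}"
  using assms
proof (induction ts arbitrary: j k)
  case (Cons t ts)
  have "set (leaves t) \<inter> set (leaves (ts ! l)) = {}" if "l < length ts" for l
    using Cons.prems(1) nth_mem[OF that] by auto
  moreover have "set (leaves (ts ! l)) \<inter> set (leaves (ts ! m)) = {}"
    if "l < length ts" "m < length ts" "l \<noteq> m" for l m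
    using Cons.prems(1) that by (intro Cons.IH) auto
  ultimately show ?case
    using Cons.prems by (cases j; cases k) auto
qed simp

lemma leaves_nth_subset: "k < length ts \<Longrightarrow> set (leaves (ts ! k)) \<subseteq> set (leaves (Node p ts))"
  by (auto intro!: bexI[of _ "ts ! k"])

lemma leaves_subtree: "subtree t K = Some s \<Longrightarrow> set (leaves s) \<subseteq> set (leaves t)"
proof (induction t K rule: subtree.induct)
  case (3 p ts k K)
  then show ?case
    using leaves_nth_subset[of k ts p] by (auto split: if_splits simp del: leaves.simps)
qed auto

lemma distinct_leaves_subtree: "subtree t K = Some s \<Longrightarrow> distinct (leaves t) \<Longrightarrow> distinct (leaves s)"
  by (induction t K rule: subtree.induct) (auto split: if_splits simp: distinct_concat_iff)

lemma admissible_subtree: "subtree t K = Some s \<Longrightarrow> admissible t \<Longrightarrow> admissible s"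
  by (induction t K rule: subtree.induct) (auto split: if_splits)

text \<open>Two incomparable multi-indices run together down to some node and then enter different
  children, whose leaves are disjoint.\<close>

lemma disjoint_leaves_subtree:
  assumes "distinct (leaves t)" "subtree t J = Some s" "subtree t K = Some u"
    and "\<not> prefix J K" "\<not> prefix K J"
  shows "set (leaves s) \<inter> set (leaves u) = {}"
  using assms
proof (induction t arbitrary: J K)
  case (Leaf i)
  then show ?case by (cases J) auto
next
  case (Node p ts)
  \<comment> \<open>Neither multi-index is empty, because the empty one is a prefix of every
    other.\<close>
  obtain j J' k K' where JK: "J = j # J'" "K = k # K'"
    using Node.prems(4,5) by (cases J; cases K) auto
  with Node.prems have jk: "j < length ts" "k < length ts"
    and sub: "subtree (ts ! j) J' = Some s" "subtree (ts ! k) K' = Some u"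
    by (auto split: if_splits)
  show ?case
  proof (cases "j = k")
    case True
    have "ts ! j \<in> set ts" using jk by simp
    moreover from this have "distinct (leaves (ts ! j))"
      using Node.prems(1) by (auto simp: distinct_concat_iff)
    ultimately show ?thesis
      using Node.prems(4,5) JK sub True by (intro Node.IH[of "ts ! j" J' K']) auto
  next
    case False
    then show ?thesis
      using disjoint_leaves_nth[of ts j k] Node.prems(1) jk leaves_subtree[OF sub(1)]
        leaves_subtree[OF sub(2)]
      by auto
  qed
qed

section \<open>Surviving coordinates and the value at the root\<close>

lemma leaves_prune_at_Node:
  assumes "I \<notin> \<J>"
  shows "set (leaves (prune_at I \<J> (Node p ts))) =
    (\<Union>k<length ts. set (leaves (prune_at (I @ [k]) \<J> (ts ! k))))"
  using assms by auto

lemma Inl_leaves_prune_at: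
  "Inl i \<in> set (leaves (prune_at I \<J> t)) \<Longrightarrow> i \<in> set (leaves t)"
proof (induction I \<J> t rule: prune_at.induct)
  case (2 I \<J> p ts)
  then have I: "I \<notin> \<J>" by auto
  with 2 leaves_nth_subset[of _ ts p] show ?case
    by (auto simp: leaves_prune_at_Node simp del: leaves.simps prune_at.simps)
qed simp

lemma Inr_leaves_prune_at:
  "Inr J \<in> set (leaves (prune_at I \<J> t)) \<Longrightarrow> J \<in> \<J>"
proof (induction I \<J> t rule: prune_at.induct)
  case (2 I \<J> p ts)
  then show ?case by (cases "I \<in> \<J>") auto
qed simp

text \<open>On the way down to the leaf of \<open>i\<close>, either a node of \<J> is met or the
  leaf survives. Members of \<J> are positions in the full tree while \<open>K\<close> is relative
  to the visited node, hence \<open>I @ K\<close>.\<close>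

lemma leaves_subset_prune_at:
  assumes "i \<in> set (leaves t)"
  shows "Inl i \<in> set (leaves (prune_at I \<J> t)) \<or>
    (\<exists>K s. I @ K \<in> \<J> \<and> subtree t K = Some s \<and> i \<in> set (leaves s))"
  using assms
proof (induction I \<J> t rule: prune_at.induct)
  case (2 I \<J> p ts)
  show ?case
  proof (cases "I \<in> \<J>")
    case True
    with 2 show ?thesis by (intro disjI2 exI[of _ "[]"]) auto
  next
    case False
    from 2 obtain s where "s \<in> set ts" "i \<in> set (leaves s)" by auto
    then obtain k where k: "k < length ts" "i \<in> set (leaves (ts ! k))"
      by (auto simp: in_set_conv_nth[of s])
    have "k \<in> set [0..<length ts]" using k by simp
    from 2(1)[OF False this k(2)]
    show ?thesis
    proof (elim disjE exE conjE)
      assume "Inl i \<in> set (leaves (prune_at (I @ [k]) \<J> (ts ! k)))"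
      with False k show ?thesis by auto
    next
      fix K s assume "(I @ [k]) @ K \<in> \<J>" "subtree (ts ! k) K = Some s" "i \<in> set (leaves s)"
      with k show ?thesis by (intro disjI2 exI[of _ "k # K"]) auto
    qed
  qed
qed simp

text \<open>The paths to a surviving leaf and to a removed node are followed together. They must
  part before the removed node is reached, since the leaf would otherwise be cut off, and from there
  distinctness separates the coordinates.\<close>

lemma Inl_leaves_prune_at_disjoint:
  assumes "distinct (leaves t)" "Inl i \<in> set (leaves (prune_at I \<J> t))"
    and "I @ K \<in> \<J>" "K \<in> inner_nodes t"
  shows "i \<notin> set (leaves (the (subtree t K)))"
  using assms
proof (induction I \<J> t arbitrary: K rule: prune_at.induct)
  case (2 I \<J> p ts)
  from 2 have I: "I \<notin> \<J>" by auto
  with 2 obtain k where k: "k < length ts" "Inl i \<in> set (leaves (prune_at (I @ [k]) \<J> (ts ! k)))"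
    by auto
  \<comment> \<open>\<open>K\<close> is not empty, since \<open>I @ []\<close> is \<open>I\<close>,
    which is not in \<J>.\<close>
  from I 2 obtain l L where K: "K = l # L" by (cases K) auto
  with 2 have l: "l < length ts" "L \<in> inner_nodes (ts ! l)"
    by (auto simp: inner_nodes_Node)
  then obtain s where s: "subtree (ts ! l) L = Some s"
    by (auto simp: inner_nodes_def)
  have dist: "distinct (leaves (ts ! k))"
    using 2(2) k by (auto simp: distinct_concat_iff)
  show ?case
  proof (cases "k = l")
    case True
    with 2(1)[OF I _ dist k(2), of L] 2(4) k(1) l K show ?thesis by auto
  next
    case False
    then show ?thesis
      using disjoint_leaves_nth[of ts k l] 2(2) k l s K leaves_subtree[OF s]
        Inl_leaves_prune_at[OF k(2)]
      by auto
  qed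
qed simp

text \<open>The root value depends on \<open>x\<close> only through the kept coordinates and the
  values at the removed nodes. This is what lets a radial density pass through the image
  measure.\<close>

lemma lp_fun_prune_at:
  assumes "\<And>i. Inl i \<in> set (leaves (prune_at I \<J> t)) \<Longrightarrow> y i = x i"
    and "\<And>K s. I @ K \<in> \<J> \<Longrightarrow> subtree t K = Some s \<Longrightarrow> v (I @ K) = lp_fun s x"
  shows "lp_fun (prune_at I \<J> t) (case_sum y v) = lp_fun t x"
  using assms
proof (induction I \<J> t rule: prune_at.induct)
  case (2 I \<J> p ts)
  show ?case
  proof (cases "I \<in> \<J>")
    case True
    \<comment> \<open>The new leaf contributes an absolute value, which is harmless because nested
      functions are nonnegative.\<close>
    with 2(3)[of "[]"] show ?thesis by (simp add: lp_fun_nonneg)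
  next
    case False
    have "lp_fun (prune_at (I @ [k]) \<J> (ts ! k)) (case_sum y v) = lp_fun (ts ! k) x"
      if k: "k < length ts" for k
    proof (rule 2(1)[OF False])
      show "y i = x i" if "Inl i \<in> set (leaves (prune_at (I @ [k]) \<J> (ts ! k)))" for i
        using that k False by (intro 2(2)) (auto simp: leaves_prune_at_Node simp del: prune_at.simps)
      show "v ((I @ [k]) @ K) = lp_fun s x"
        if "(I @ [k]) @ K \<in> \<J>" "subtree (ts ! k) K = Some s" for K s
        using 2(3)[of "k # K" s] that k by simp
    qed (use k in simp)
    then have "map (\<lambda>k. lp_fun (prune_at (I @ [k]) \<J> (ts ! k)) (case_sum y v) powr p) [0..<length ts] =
        map (\<lambda>k. lp_fun (ts ! k) x powr p) [0..<length ts]"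
      by simp
    also have "\<dots> = map (\<lambda>t. lp_fun t x powr p) ts"
      by (rule nth_equalityI) auto
    finally show ?thesis using False by (simp add: comp_def)
  qed
qed simp

section \<open>Lebesgue measure seen through the pruned tree\<close>

lemma set_leaves_eq_remaining_coords_Un:
  assumes "\<J> \<subseteq> inner_nodes t"
  shows "set (leaves t) = remaining_coords \<J> t \<union> (\<Union>J\<in>\<J>. set (leaves (the (subtree t J))))"
proof (intro set_eqI iffI)
  fix i assume "i \<in> set (leaves t)"
  then show "i \<in> remaining_coords \<J> t \<union> (\<Union>J\<in>\<J>. set (leaves (the (subtree t J))))"
    using leaves_subset_prune_at[of i t "[]" \<J>] by (force simp: remaining_coords_def)
next
  fix i assume "i \<in> remaining_coords \<J> t \<union> (\<Union>J\<in>\<J>. set (leaves (the (subtree t J))))"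
  moreover have "set (leaves (the (subtree t J))) \<subseteq> set (leaves t)" if "J \<in> \<J>" for J
  proof (rule leaves_subtree)
    show "subtree t J = Some (the (subtree t J))"
      using assms that by (auto simp: inner_nodes_def)
  qed
  ultimately show "i \<in> set (leaves t)"
    by (auto simp: remaining_coords_def dest: Inl_leaves_prune_at)
qed

text \<open>The coordinates split into the kept ones and one disjoint block per removed subtree. The
  map is the identity on the former, while each block is sent to its radial law by
  \<open>distr_lp_fun\<close>; the image is the product of these measures.\<close>

lemma distr_remaining_coords:
  fixes t :: "'i lp_tree"
  assumes t: "admissible t" "distinct (leaves t)" and rem: "removable t \<J>"
  defines "R \<equiv> remaining_coords \<J> t" and "s \<equiv> \<lambda>J. the (subtree t J)"
  defines "N \<equiv> lebesgue_on_coords R \<Otimes>\<^sub>M lebesgue_on_coords \<J>"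
    and "\<Phi> \<equiv> \<lambda>x. (restrict x R, \<lambda>J\<in>\<J>. lp_fun (s J) x)"
  shows "\<Phi> \<in> lebesgue_on_coords (set (leaves t)) \<rightarrow>\<^sub>M N"
    and "distr (lebesgue_on_coords (set (leaves t))) N \<Phi> =
      density N (\<lambda>(x, v). \<Prod>J\<in>\<J>. ennreal (surface_area (s J) 1 * v J powr (real (num_leaves (s J)) - 1)) *
        indicator {0<..} (v J))"
proof -
  interpret L: product_sigma_finite "\<lambda>_::'i. lborel :: real measure"
    by (rule product_sigma_finite_lborel)
  interpret LJ: product_sigma_finite "\<lambda>_::nat list. lborel :: real measure"
    by (rule product_sigma_finite_lborel)
  define D where "D J = power_measure (surface_area (s J) 1) (real (num_leaves (s J)))" for J
  let ?d = "\<lambda>J u. ennreal (surface_area (s J) 1 * u powr (real (num_leaves (s J)) - 1)) *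
        indicator {0<..} u"
  let ?K = "\<lambda>J. set (leaves (s J))"
  let ?U = "\<Union>J\<in>\<J>. ?K J"
  let ?V = "set (leaves t)"
  let ?g = "\<lambda>x. \<lambda>J\<in>\<J>. lp_fun (s J) (restrict x (?K J))"
  have D_eq: "D = (\<lambda>J. density lborel (?d J))"
    by (simp add: D_def power_measure_def fun_eq_iff)
  \<comment> \<open>The product of the radial laws has the same measurable sets as the Lebesgue
    product, so either can serve as target space of the image.\<close>
  have sets_D: "sets (Pi\<^sub>M \<J> D) = sets (lebesgue_on_coords \<J>)"
    by (rule sets_PiM_cong) (simp_all add: D_def)
  interpret D: product_sigma_finite D
    unfolding D_def by (intro product_sigma_finite.intro sigma_finite_power_measure)
  have sub: "\<J> \<subseteq> inner_nodes t" and anti: "\<And>I J. I \<in> \<J> \<Longrightarrow> J \<in> \<J> \<Longrightarrow> prefix I J \<Longrightarrow> I = J"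
    using rem by (auto simp: removable_def)
  have fin: "finite \<J>" using sub finite_inner_nodes by (rule finite_subset)
  have s: "subtree t J = Some (s J)" if "J \<in> \<J>" for J
    using sub that by (auto simp: inner_nodes_def s_def)
  have V: "?V = R \<union> ?U"
    unfolding R_def s_def by (rule set_leaves_eq_remaining_coords_Un[OF sub])
  have RU: "R \<inter> ?U = {}"
    using Inl_leaves_prune_at_disjoint[OF t(2), of _ "[]" \<J>] sub
    by (auto simp: R_def remaining_coords_def s_def)
  have finR: "finite R"
    using V by (metis List.finite_set finite_Un)
  \<comment> \<open>Distinct members of \<J> are incomparable by \<open>removable\<close>, so their
    subtrees share no coordinate.\<close>
  have disj: "disjoint_family_on ?K \<J>"
    unfolding disjoint_family_on_def
    using disjoint_leaves_subtree[OF t(2) s s] anti by metis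
  have g_eq: "?g (restrict x ?U) = (\<lambda>J\<in>\<J>. lp_fun (s J) x)" for x
    by (rule restrict_ext) (auto intro!: lp_fun_cong)
  have h: "lp_fun (s J) \<in> borel_measurable (lebesgue_on_coords L)" if "?K J \<subseteq> L" for J L
    using that by (rule borel_measurable_lp_fun_PiM)
  have \<Phi>2: "(\<lambda>x. \<lambda>J\<in>\<J>. lp_fun (s J) x) \<in> lebesgue_on_coords ?V \<rightarrow>\<^sub>M lebesgue_on_coords \<J>"
  proof (rule measurable_restrict)
    fix J assume "J \<in> \<J>"
    then have "lp_fun (s J) \<in> borel_measurable (lebesgue_on_coords ?V)"
      using V by (intro h) auto
    then show "lp_fun (s J) \<in> lebesgue_on_coords ?V \<rightarrow>\<^sub>M lborel" by simp
  qed
  have \<Phi>1: "(\<lambda>x. restrict x R) \<in> lebesgue_on_coords ?V \<rightarrow>\<^sub>M lebesgue_on_coords R"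
    using V by (intro measurable_restrict_subset) auto
  show "\<Phi> \<in> lebesgue_on_coords ?V \<rightarrow>\<^sub>M N"
    unfolding \<Phi>_def N_def by (rule measurable_Pair[OF \<Phi>1 \<Phi>2])
  have gm: "?g \<in> lebesgue_on_coords ?U \<rightarrow>\<^sub>M Pi\<^sub>M \<J> D"
  proof (rule measurable_restrict)
    fix J assume "J \<in> \<J>"
    have "(\<lambda>x. lp_fun (s J) (restrict x (?K J))) \<in> borel_measurable (lebesgue_on_coords ?U)"
      by (subst lp_fun_restrict) (use \<open>J \<in> \<J>\<close> in \<open>auto intro: h\<close>)
    then show "(\<lambda>x. lp_fun (s J) (restrict x (?K J))) \<in> lebesgue_on_coords ?U \<rightarrow>\<^sub>M D J"
      by (simp add: D_def cong: measurable_cong_sets)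
  qed
  have blocks: "distr (lebesgue_on_coords ?U) (Pi\<^sub>M \<J> D) ?g = Pi\<^sub>M \<J> D"
  proof (rule L.distr_blocks[OF fin D.product_sigma_finite_axioms disj])
    fix J assume "J \<in> \<J>"
    have "lp_fun (s J) \<in> borel_measurable (lebesgue_on_coords (?K J))"
      by (rule h) simp
    then show "lp_fun (s J) \<in> lebesgue_on_coords (?K J) \<rightarrow>\<^sub>M D J"
      by (simp add: D_def cong: measurable_cong_sets)
    have "distr (lebesgue_on_coords (?K J)) (D J) (lp_fun (s J)) =
        distr (lebesgue_on_coords (?K J)) borel (lp_fun (s J))"
      by (rule distr_cong) (simp_all add: D_def)
    also have "\<dots> = D J"
      unfolding D_def
      using distr_lp_fun admissible_subtree[OF s] distinct_leaves_subtree[OF s] \<open>J \<in> \<J>\<close> t by blast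
    finally show "distr (lebesgue_on_coords (?K J)) (D J) (lp_fun (s J)) = D J" .
  qed simp
  have dens: "Pi\<^sub>M \<J> D = density (lebesgue_on_coords \<J>) (\<lambda>v. \<Prod>J\<in>\<J>. ?d J (v J))"
    unfolding D_eq
    by (rule LJ.PiM_density[OF fin _ D.product_sigma_finite_axioms[unfolded D_eq]]) measurable
  have "distr (lebesgue_on_coords ?V) N \<Phi> =
      distr (lebesgue_on_coords (R \<union> ?U)) (lebesgue_on_coords R \<Otimes>\<^sub>M Pi\<^sub>M \<J> D)
        (\<lambda>x. (restrict x R, ?g (restrict x ?U)))"
    unfolding V N_def \<Phi>_def
    by (rule distr_cong) (simp_all only: g_eq sets_D sets_pair_measure_cong[OF refl sets_D])
  also have "\<dots> = distr (lebesgue_on_coords R) (lebesgue_on_coords R) (\<lambda>x. x) \<Otimes>\<^sub>M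
      distr (lebesgue_on_coords ?U) (Pi\<^sub>M \<J> D) ?g"
  proof (rule L.distr_pair_blocks[OF RU finR _ _ gm])
    show "sigma_finite_measure (distr (lebesgue_on_coords ?U) (Pi\<^sub>M \<J> D) ?g)"
      unfolding blocks by (rule D.sigma_finite[OF fin])
  qed (use fin in auto)
  \<comment> \<open>Lebesgue measure on the kept coordinates is written with the constant density 1
    so that the rule for products of densities applies.\<close>
  also have "\<dots> = density (lebesgue_on_coords R) (\<lambda>_. 1) \<Otimes>\<^sub>M
      density (lebesgue_on_coords \<J>) (\<lambda>v. \<Prod>J\<in>\<J>. ?d J (v J))"
    by (simp only: blocks distr_id density_1 dens[symmetric])
  also have "\<dots> = density N (\<lambda>(x, v). 1 * (\<Prod>J\<in>\<J>. ?d J (v J)))"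
    unfolding N_def
  proof (rule pair_measure_density)
    show "sigma_finite_measure (lebesgue_on_coords \<J>)"
      by (rule LJ.sigma_finite[OF fin])
    show "sigma_finite_measure (density (lebesgue_on_coords \<J>) (\<lambda>v. \<Prod>J\<in>\<J>. ?d J (v J)))"
      unfolding dens[symmetric] by (rule D.sigma_finite[OF fin])
  qed measurable
  finally show "distr (lebesgue_on_coords ?V) N \<Phi> = density N (\<lambda>(x, v). \<Prod>J\<in>\<J>. ?d J (v J))"
    by simp
qed

text \<open>The density refers to Lebesgue measure on the pair. Beside the power of
  \<open>v J\<close>, each removed subtree therefore contributes the constant
  \<open>surface_area (the (subtree t J)) 1\<close>, left over from integrating out its uniform
  component. The value 0 outside the positive orthant reflects that the radial laws live on the open
  half-line.\<close>

theorem proposition4: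
  fixes M :: "'a measure" and n :: nat and t :: "nat lp_tree" and \<rho> :: "real \<Rightarrow> real"
    and X :: "'a \<Rightarrow> nat \<Rightarrow> real" and \<J> :: "nat list set"
  assumes "prob_space M"
    and "lp_nested_tree n t"
    and "radial_density \<rho>"
    and "lp_nested_symmetric M n t \<rho> X"
    and "removable t \<J>"
  shows "distributed M
    (lebesgue_on_coords (remaining_coords \<J> t) \<Otimes>\<^sub>M lebesgue_on_coords \<J>)
    (\<lambda>\<omega>. (restrict (X \<omega>) (remaining_coords \<J> t),
          \<lambda>J\<in>\<J>. lp_fun (the (subtree t J)) (X \<omega>)))
    (\<lambda>(x, v).
      let r = lp_fun (prune \<J> t) (case_sum x v)
      in if \<forall>J\<in>\<J>. 0 < v J
         then ennreal (\<rho> r / surface_area t r *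
           (\<Prod>J\<in>\<J>. surface_area (the (subtree t J)) 1 *
                   v J ^ (num_leaves (the (subtree t J)) - 1)))
         else 0)"
proof -
  let ?R = "remaining_coords \<J> t"
  let ?s = "\<lambda>J. the (subtree t J)"
  let ?N = "lebesgue_on_coords ?R \<Otimes>\<^sub>M lebesgue_on_coords \<J>"
  let ?\<Phi> = "\<lambda>x. (restrict x ?R, \<lambda>J\<in>\<J>. lp_fun (?s J) x)"
  let ?r = "\<lambda>z. lp_fun (prune \<J> t) (case_sum (fst z) (snd z))"
  let ?d = "\<lambda>(x :: nat \<Rightarrow> real, v). \<Prod>J\<in>\<J>. ennreal (surface_area (?s J) 1 *
      v J powr (real (num_leaves (?s J)) - 1)) * indicator {0<..} (v J)"
  let ?q = "\<lambda>r. ennreal (\<rho> r / surface_area t r)"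
  from assms have t: "admissible t" "distinct (leaves t)" and n: "{..<n} = set (leaves t)"
    by (auto simp: lp_nested_tree_def)
  from assms have [measurable]: "\<rho> \<in> borel_measurable borel"
    by (simp add: radial_density_def)
  from assms have sub: "\<J> \<subseteq> inner_nodes t" by (simp add: removable_def)
  have fin: "finite \<J>" using sub finite_inner_nodes by (rule finite_subset)
  have X: "X \<in> M \<rightarrow>\<^sub>M lebesgue_on_coords {..<n}"
    and distr_X: "distr M (lebesgue_on_coords {..<n}) X =
      density (lebesgue_on_coords {..<n}) (\<lambda>x. ?q (lp_fun t x))"
    using assms(4) by (auto simp: lp_nested_symmetric_def distributed_def)
  have \<Phi>: "?\<Phi> \<in> lebesgue_on_coords {..<n} \<rightarrow>\<^sub>M ?N"
    and distr_\<Phi>: "distr (lebesgue_on_coords {..<n}) ?N ?\<Phi> = density ?N ?d"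
    using distr_remaining_coords[OF t assms(5)] by (simp_all add: n)
  \<comment> \<open>The image point determines the radius, so the density of \<open>X\<close>
    factors through the map.\<close>
  have r: "?r (?\<Phi> x) = lp_fun t x" for x
    unfolding fst_conv snd_conv
    by (rule lp_fun_prune_at) (auto simp: remaining_coords_def)
  have [measurable]: "?r \<in> borel_measurable ?N"
  proof (rule borel_measurable_lp_fun)
    fix k assume k: "k \<in> set (leaves (prune \<J> t))"
    show "(\<lambda>z. case_sum (fst z) (snd z) k) \<in> borel_measurable ?N"
    proof (cases k)
      case (Inl i)
      with k have "i \<in> ?R" by (simp add: remaining_coords_def)
      then have "(\<lambda>z. fst z i) \<in> ?N \<rightarrow>\<^sub>M lborel"
        by (intro measurable_compose[OF measurable_fst measurable_component_singleton])
      with Inl show ?thesis by simp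
    next
      case (Inr J)
      with k have "J \<in> \<J>" using Inr_leaves_prune_at by auto
      then have "(\<lambda>z. snd z J) \<in> ?N \<rightarrow>\<^sub>M lborel"
        by (intro measurable_compose[OF measurable_snd measurable_component_singleton])
      with Inr show ?thesis by simp
    qed
  qed
  have q [measurable]: "?q \<in> borel_measurable borel"
    unfolding surface_area_def by measurable
  have d: "?d \<in> borel_measurable ?N"
    unfolding case_prod_beta' by measurable
  let ?F = "\<lambda>(x, v).
      let r = lp_fun (prune \<J> t) (case_sum x v)
      in if \<forall>J\<in>\<J>. 0 < v J
         then ennreal (\<rho> r / surface_area t r *
           (\<Prod>J\<in>\<J>. surface_area (?s J) 1 * v J ^ (num_leaves (?s J) - 1)))
         else 0"
  \<comment> \<open>Matches the stated density with the product that the image computation yields.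
    Where all \<open>v J\<close> are positive, real powers become natural powers; otherwise some
    indicator makes the product vanish.\<close>
  have F: "?F = (\<lambda>z. ?d z * ?q (?r z))"
  proof (rule ext)
    fix z :: "(nat \<Rightarrow> real) \<times> (nat list \<Rightarrow> real)"
    obtain x v where z: "z = (x, v)" by (cases z)
    let ?p = "\<Prod>J\<in>\<J>. surface_area (?s J) 1 * v J ^ (num_leaves (?s J) - 1)"
    have "?F (x, v) = ?d (x, v) * ?q (?r (x, v))"
    proof (cases "\<forall>J\<in>\<J>. 0 < v J")
      case True
      have fac: "0 \<le> surface_area (?s J) 1 * v J ^ (num_leaves (?s J) - 1) \<and>
          surface_area (?s J) 1 * v J powr (real (num_leaves (?s J)) - 1) =
          surface_area (?s J) 1 * v J ^ (num_leaves (?s J) - 1)" if "J \<in> \<J>" for J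
      proof -
        have "subtree t J = Some (?s J)"
          using sub that by (auto simp: inner_nodes_def)
        then have "admissible (?s J)" using t(1) by (rule admissible_subtree)
        then have "0 < surface_area (?s J) 1" "0 < num_leaves (?s J)"
          by (rule surface_area_pos, rule num_leaves_pos)
        \<comment> \<open>Positivity of the number of leaves makes the truncated subtraction of 1
          agree with the real one.\<close>
        moreover from this(2) have "real (num_leaves (?s J)) - 1 = real (num_leaves (?s J) - 1)"
          by (simp only: of_nat_diff Suc_leI One_nat_def of_nat_Suc of_nat_0 add_0)
        ultimately show ?thesis
          using True that by (auto simp: powr_realpow simp del: One_nat_def of_nat_diff)
      qed
      have "?d (x, v) = (\<Prod>J\<in>\<J>. ennreal (surface_area (?s J) 1 * v J ^ (num_leaves (?s J) - 1)))"
        unfolding case_prod_conv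
      proof (rule prod.cong[OF refl])
        fix J assume J: "J \<in> \<J>"
        with True have "indicator {0<..} (v J) = (1 :: ennreal)" by simp
        then show "ennreal (surface_area (?s J) 1 * v J powr (real (num_leaves (?s J)) - 1)) *
            indicator {0<..} (v J) = ennreal (surface_area (?s J) 1 * v J ^ (num_leaves (?s J) - 1))"
          by (simp only: fac[OF J] mult_1_right)
      qed
      also have "\<dots> = ennreal ?p"
        using fac by (intro prod_ennreal) auto
      finally have d_eq: "?d (x, v) = ennreal ?p" .
      have p: "0 \<le> ?p" using fac by (intro prod_nonneg) auto
      have "?F (x, v) = ennreal (\<rho> (?r (x, v)) / surface_area t (?r (x, v)) * ?p)"
        unfolding case_prod_conv Let_def fst_conv snd_conv using True by (rule if_P)
      also have "\<dots> = ?q (?r (x, v)) * ennreal ?p"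
        \<comment> \<open>This rule asks for the sign of the second factor alone; the first may be
          negative at radius 0, as \<open>\<rho>\<close> is constrained only at positive
          radii.\<close>
        by (rule ennreal_mult''[OF p])
      finally show ?thesis
        unfolding d_eq by (simp only: mult.commute)
    next
      case False
      then have "?d (x, v) = 0"
        unfolding case_prod_conv by (intro prod_zero[OF fin]) (auto intro!: bexI)
      moreover have "?F (x, v) = 0"
        unfolding case_prod_conv Let_def using False by (rule if_not_P)
      ultimately show ?thesis by (simp only: mult_zero_left)
    qed
    then show "?F z = ?d z * ?q (?r z)" unfolding z .
  qed
  have "distr M ?N (\<lambda>\<omega>. ?\<Phi> (X \<omega>)) = distr (distr M (lebesgue_on_coords {..<n}) X) ?N ?\<Phi>"
    using distr_distr[OF \<Phi> X] by (simp add: comp_def)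
  \<comment> \<open>Once the density is written as a function of the image point, it can be moved
    outside the image measure.\<close>
  also have "\<dots> = distr (density (lebesgue_on_coords {..<n}) (\<lambda>x. ?q (?r (?\<Phi> x)))) ?N ?\<Phi>"
    by (simp only: distr_X r)
  also have "\<dots> = density (distr (lebesgue_on_coords {..<n}) ?N ?\<Phi>) (\<lambda>z. ?q (?r z))"
    by (rule density_distr[symmetric, OF _ \<Phi>]) measurable
  also have "\<dots> = density ?N (\<lambda>z. ?d z * ?q (?r z))"
    unfolding distr_\<Phi> by (rule density_density_eq[OF d]) measurable
  finally have "distr M ?N (\<lambda>\<omega>. ?\<Phi> (X \<omega>)) = density ?N (\<lambda>z. ?d z * ?q (?r z))" .
  moreover have "(\<lambda>z. ?d z * ?q (?r z)) \<in> borel_measurable ?N"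
    using d by measurable
  ultimately show ?thesis
    unfolding distributed_def F using measurable_compose[OF X \<Phi>] by simp
qed

end
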